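(* Let $\phi(\mathbf{x})$ be the energy density function defined over the material space $\Omega$ of affine body $i$. Then Newton's second law in terms of affine coordinates is formulated as $$\mathbf{M}_i\ddot{\mathbf{q}}_i=-\int_\Omega\nabla_{\mathbf{q}_i}\phi(\mathbf{x})\,d\Omega .$$
   Context: An affine body $i$ has kinematics $\mathbf{y}=\mathbf{A}_i\mathbf{x}+\mathbf{c}_i$ with a time-varying linear transform $\mathbf{A}_i(t)\in\mathbb{R}^{3\times3}$ and a translation $\mathbf{c}_i(t)\in\mathbb{R}^3$, where $\mathbf{x}$ denotes material coordinates defined in body $i$'s frame and $\mathbf{y}$ the corresponding world coordinates. The generalized (affine) coordinates are $\mathbf{q}_i=(\mathbf{c}_i^T,\mathbf{a}_1^T,\mathbf{a}_2^T,\mathbf{a}_3^T)^T\in\mathbb{R}^{12}$ with $\mathbf{A}_i=[\mathbf{a}_1,\mathbf{a}_2,\mathbf{a}_3]^T$, and the Jacobian is $\mathbf{J}(\mathbf{x})=[\mathbf{I}_3,\mathbf{I}_3\otimes\mathbf{x}^T]\in\mathbb{R}^{3\times12}$, so that $\mathbf{y}=\mathbf{J}(\mathbf{x})\mathbf{q}_i$. $\mathbf{I}_3$ is the $3\times3$ identity and $\nabla_{\mathbf{q}_i}$ is the gradient with respect to $\mathbf{q}_i$, a column vector in $\mathbb{R}^{12}$. The generalized mass matrix is the $12\times12$ block diagonal matrix $\mathbf{M}_i=\mathrm{diag}(m_i\mathbf{I}_3,\Pi_i,\Pi_i,\Pi_i)$, where $m_i$ is the mass of body $i$, $\rho$ its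 mass density, and $\Pi_i=\int_\Omega\rho\,\mathbf{x}\mathbf{x}^T\,dV$ its affine moment of inertia. The energy density depends on the configuration through the world position $\mathbf{y}$, and by the constitutive relation of continuum mechanics the associated elastic force density is $\mathbf{f}(\mathbf{x})=-[\partial\phi(\mathbf{x})/\partial\mathbf{y}]^T$. Newton's second law is $\rho\,\ddot{\mathbf{y}}=\mathbf{f}$; its formulation in terms of affine coordinates is obtained by multiplying by $\mathbf{J}^T$ and integrating over $\Omega$.
   Formalization: The formal theorem adds that the body frame's origin is at the centre of mass (the integral of ρx over Ω is zero); without this the block-diagonal mass matrix omits coupling terms and the law fails, e.g. for a unit cube with a corner at the origin under a constant force. *)

theory Defs
  imports "HOL-Analysis.Analysis"
begin

text \<open>
  The index type of \<open>\<real>\<^sup>1\<^sup>2\<close>, keeping the block structure visible: \<open>Inl k\<close> is the \<open>k\<close>-th component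
  of the translation \<open>c\<close>, and \<open>Inr (k, j)\<close> is the \<open>j\<close>-th component of \<open>a\<^sub>k\<close>, the \<open>k\<close>-th row of \<open>A\<close>.
\<close>
type_synonym coord = "3 + 3 \<times> 3"

lemma card_coord: "CARD(coord) = 12"
  by simp

definition affine_coords :: "real^3^3 \<Rightarrow> real^3 \<Rightarrow> real^coord" where
  "affine_coords A c = (\<chi> i. case i of Inl k \<Rightarrow> c $ k | Inr (k, j) \<Rightarrow> row k A $ j)"

text \<open>\<open>J(x) = [I\<^sub>3, I\<^sub>3 \<otimes> x\<^sup>T]\<close>; column \<open>(l, j)\<close> of the Kronecker block has entries \<open>(I\<^sub>3)\<^sub>k\<^sub>l x\<^sub>j\<close>.\<close>
definition affine_jacobian :: "real^3 \<Rightarrow> real^coord^3" where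
  "affine_jacobian x = (\<chi> k i. case i of
      Inl l \<Rightarrow> (mat 1 :: real^3^3) $ k $ l
    | Inr (l, j) \<Rightarrow> (mat 1 :: real^3^3) $ k $ l * x $ j)"

definition world_pos :: "real^3^3 \<Rightarrow> real^3 \<Rightarrow> real^3 \<Rightarrow> real^3" where
  "world_pos A c x = A *v x + c"

lemma world_pos_eq_jacobian:
  "world_pos A c x = affine_jacobian x *v affine_coords A c"
proof -
  have *: "(\<Sum>i\<in>(UNIV::coord set). g i) = (\<Sum>l\<in>UNIV. g (Inl l)) + (\<Sum>l\<in>UNIV. \<Sum>j\<in>UNIV. g (Inr (l, j)))"
    for g :: "coord \<Rightarrow> real"
    by (simp add: UNIV_Plus_UNIV [symmetric] sum.Plus sum.cartesian_product UNIV_Times_UNIV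
             del: UNIV_Plus_UNIV)
  have if_out: "(\<Sum>j\<in>UNIV. (if P then f j else 0)) = (if P then sum f UNIV else 0)"
    for P and f :: "3 \<Rightarrow> real"
    by simp
  show ?thesis
    by (simp add: vec_eq_iff world_pos_def affine_jacobian_def affine_coords_def
        matrix_vector_mult_def row_def mat_def * if_distrib if_distribR if_out mult.commute
        cong: if_cong)
qed

definition body_mass :: "(real^3) set \<Rightarrow> (real^3 \<Rightarrow> real) \<Rightarrow> real" where
  "body_mass \<Omega> \<rho> = (LINT x:\<Omega>|lebesgue. \<rho> x)"

definition outer_square :: "real^3 \<Rightarrow> real^3^3" where
  "outer_square x = (columnvector x :: real^1^3) ** (rowvector x :: real^3^1)"

definition affine_inertia :: "(real^3) set \<Rightarrow> (real^3 \<Rightarrow> real) \<Rightarrow> real^3^3" where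
  "affine_inertia \<Omega> \<rho> = (LINT x:\<Omega>|lebesgue. \<rho> x *\<^sub>R outer_square x)"

text \<open>The block diagonal matrix \<open>diag(m I\<^sub>3, \<Pi>, \<Pi>, \<Pi>)\<close>.\<close>
definition mass_matrix :: "(real^3) set \<Rightarrow> (real^3 \<Rightarrow> real) \<Rightarrow> real^coord^coord" where
  "mass_matrix \<Omega> \<rho> = (\<chi> i i'. case (i, i') of
      (Inl k, Inl l) \<Rightarrow> body_mass \<Omega> \<rho> * (mat 1 :: real^3^3) $ k $ l
    | (Inr (k, j), Inr (l, j')) \<Rightarrow> (if k = l then affine_inertia \<Omega> \<rho> $ j $ j' else 0)
    | _ \<Rightarrow> 0)"

text \<open>Meaningful only where \<open>f\<close> is differentiable; there it is characterised by \<open>grad_eqI\<close>.\<close>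
definition grad :: "('a::real_inner \<Rightarrow> real) \<Rightarrow> 'a \<Rightarrow> 'a" where
  "grad f p = (THE g. GDERIV f p :> g)"

lemma grad_eqI: "grad f p = g" if "GDERIV f p :> g"
  unfolding grad_def
proof (rule the_equality [where P = "\<lambda>g. GDERIV f p :> g", OF that])
  fix g' assume "GDERIV f p :> g'"
  then have "(\<lambda>h. inner h g') = (\<lambda>h. inner h g)"
    using that unfolding gderiv_def by (rule has_derivative_unique)
  then have "inner h (g' - g) = 0" for h
    by (metis inner_diff_right cancel_comm_monoid_add_class.diff_cancel)
  then show "g' = g"
    by (metis inner_eq_zero_iff right_minus_eq)
qed

text \<open>The energy density \<open>\<phi> x y\<close> of the material point \<open>x\<close> depends on its world position \<open>y\<close>;
  the force density is \<open>-(\<partial>\<phi>/\<partial>y)\<^sup>T\<close>.\<close>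
definition elastic_force :: "(real^3 \<Rightarrow> real^3 \<Rightarrow> real) \<Rightarrow> real^3 \<Rightarrow> real^3 \<Rightarrow> real^3" where
  "elastic_force \<phi> x y = - grad (\<phi> x) y"

definition second_derivative :: "(real \<Rightarrow> 'a::real_normed_vector) \<Rightarrow> real \<Rightarrow> 'a" where
  "second_derivative u t =
     vector_derivative (\<lambda>s. vector_derivative u (at s)) (at t)"

definition twice_differentiable_at :: "(real \<Rightarrow> 'a::real_normed_vector) \<Rightarrow> real \<Rightarrow> bool" where
  "twice_differentiable_at u t \<longleftrightarrow>
     (\<forall>\<^sub>F s in nhds t. u differentiable (at s)) \<and>
     (\<lambda>s. vector_derivative u (at s)) differentiable (at t)"

end

theory Submission
  imports Defs
begin

text \<open>
  Since \<open>y = J(x) q\<close> with \<open>J(x)\<close> constant in time, \<open>\<rho> J\<^sup>T y'' = (\<rho> J\<^sup>T J) q''\<close>, and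
  \<open>\<integral> \<rho> J\<^sup>T J = M\<close>: the blocks coupling translation and deformation are first moments of \<open>\<rho>\<close>, which
  vanish because the body frame is centred. On the right-hand side the chain rule turns
  \<open>J\<^sup>T (\<partial>\<phi>/\<partial>y)\<^sup>T\<close> into the gradient of \<open>\<phi>\<close> with respect to \<open>q\<close>.
\<close>

section \<open>Bounded linear maps and set integrals\<close>

lemma bounded_linear_axis: "bounded_linear (axis i :: 'b::euclidean_space \<Rightarrow> 'b^'n)"
  by (rule linear_conv_bounded_linear[THEN iffD1], rule linearI)
    (auto simp: vec_eq_iff axis_def)

lemma set_integrable_bounded_linear:
  assumes "bounded_linear T" "set_integrable M S f"
  shows "set_integrable M S (\<lambda>x. T (f x))"
proof -
  interpret T: bounded_linear T by fact
  show ?thesis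
    using integrable_bounded_linear[OF assms(1), of M "\<lambda>x. indicator S x *\<^sub>R f x"] assms(2)
    by (simp add: set_integrable_def T.scale)
qed

text \<open>A vector is the finite sum of its components embedded along the axes, and each embedding
  is bounded linear.\<close>

lemma set_integrable_vec:
  fixes f :: "'a \<Rightarrow> 'b::euclidean_space^'n"
  assumes "\<And>i. set_integrable M S (\<lambda>x. f x $ i)"
  shows "set_integrable M S f"
proof -
  have "set_integrable M S (\<lambda>x. axis i (f x $ i) :: 'b^'n)" for i
    using assms by (rule set_integrable_bounded_linear[OF bounded_linear_axis])
  then have "set_integrable M S (\<lambda>x. \<Sum>i\<in>UNIV. axis i (f x $ i))"
    unfolding set_integrable_def scaleR_sum_right by (intro Bochner_Integration.integrable_sum)
  moreover have "(\<Sum>i\<in>UNIV. axis i (f x $ i)) = f x" for x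
    by (simp add: vec_eq_iff axis_def)
  ultimately show ?thesis
    by simp
qed

lemma set_integral_bounded_linear:
  assumes "bounded_linear T" "set_integrable M S f"
  shows "(LINT x:S|M. T (f x)) = T (LINT x:S|M. f x)"
proof -
  interpret T: bounded_linear T by fact
  show ?thesis
    using integral_bounded_linear[OF assms(1), of M "\<lambda>x. indicator S x *\<^sub>R f x"] assms(2)
    by (simp add: set_lebesgue_integral_def set_integrable_def T.scale)
qed

lemma set_integral_vec_nth:
  fixes f :: "'a \<Rightarrow> 'b::euclidean_space^'n"
  assumes "set_integrable M S f"
  shows "(LINT x:S|M. f x) $ i = (LINT x:S|M. f x $ i)"
  using set_integral_bounded_linear[OF bounded_linear_vec_nth assms] by simp

lemma bounded_linear_matrix_vector_mult_left:
  "bounded_linear (\<lambda>M::real^'n^'m. M *v v)"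
  by (rule linear_conv_bounded_linear[THEN iffD1], rule linearI)
    (auto simp: vec_eq_iff matrix_vector_mult_def distrib_right sum.distrib
        sum_distrib_left mult.assoc)

section \<open>Second time derivatives\<close>

lemma twice_differentiable_at_bounded_linear:
  assumes "bounded_linear L" "twice_differentiable_at u t"
  shows "twice_differentiable_at (\<lambda>s. L (u s)) t" (is ?D)
    and "second_derivative (\<lambda>s. L (u s)) t = L (second_derivative u t)" (is ?E)
proof -
  let ?du = "\<lambda>s. vector_derivative u (at s)"
  let ?dLu = "\<lambda>s. vector_derivative (\<lambda>s. L (u s)) (at s)"
  have ev: "\<forall>\<^sub>F s in nhds t. u differentiable (at s)"
    and du: "(?du has_vector_derivative second_derivative u t) (at t)"
    using assms(2)
    by (auto simp: twice_differentiable_at_def second_derivative_def vector_derivative_works)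
  have L: "((\<lambda>s. L (u s)) has_vector_derivative L (?du s)) (at s)" if "u differentiable (at s)" for s
    using bounded_linear.has_vector_derivative[OF assms(1)] that
    by (simp add: vector_derivative_works)
  \<comment> \<open>\<open>u\<close> is assumed differentiable only near \<open>t\<close>, so the
    first derivatives are compared only there. Agreement on a neighbourhood that contains
    \<open>t\<close> itself is enough to transfer the derivative at \<open>t\<close>.\<close>
  have "\<forall>\<^sub>F s in nhds t. L (?du s) = ?dLu s"
    using ev by eventually_elim (metis L vector_derivative_at)
  moreover have "((\<lambda>s. L (?du s)) has_vector_derivative L (second_derivative u t)) (at t)"
    using bounded_linear.has_vector_derivative[OF assms(1) du] .
  ultimately have dLu: "(?dLu has_vector_derivative L (second_derivative u t)) (at t)"
    using has_vector_derivative_cong_ev[of UNIV "\<lambda>s. L (?du s)" ?dLu t]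
    by (auto dest: eventually_nhds_x_imp_x)
  then show ?E
    by (simp add: second_derivative_def vector_derivative_at)
  show ?D
    unfolding twice_differentiable_at_def
  proof
    show "\<forall>\<^sub>F s in nhds t. (\<lambda>s. L (u s)) differentiable (at s)"
      using ev by eventually_elim (use L in \<open>blast intro: differentiableI_vector\<close>)
    show "?dLu differentiable (at t)"
      using dLu by (rule differentiableI_vector)
  qed
qed

lemma twice_differentiable_at_add:
  assumes "twice_differentiable_at u t" "twice_differentiable_at v t"
  shows "twice_differentiable_at (\<lambda>s. u s + v s) t"
proof -
  let ?d = "\<lambda>s. vector_derivative (\<lambda>s. u s + v s) (at s)"
  let ?e = "\<lambda>s. vector_derivative u (at s) + vector_derivative v (at s)"
  have ev: "\<forall>\<^sub>F s in nhds t. u differentiable (at s) \<and> v differentiable (at s)"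
    and e: "?e differentiable (at t)"
    using assms by (auto simp: twice_differentiable_at_def eventually_conj_iff)
  have "\<forall>\<^sub>F s in nhds t. ?e s = ?d s"
    using ev by eventually_elim
      (metis has_vector_derivative_add vector_derivative_works vector_derivative_at)
  then have "(?d has_vector_derivative vector_derivative ?e (at t)) (at t)"
    using e has_vector_derivative_cong_ev[of UNIV ?e ?d t]
    by (auto simp: vector_derivative_works dest: eventually_nhds_x_imp_x)
  then have "?d differentiable (at t)"
    by (rule differentiableI_vector)
  moreover have "\<forall>\<^sub>F s in nhds t. (\<lambda>s. u s + v s) differentiable (at s)"
    using ev by eventually_elim (auto intro: differentiable_add)
  ultimately show ?thesis
    by (simp add: twice_differentiable_at_def)
qed

text \<open>\<open>affine_coords\<close> is jointly linear, so it splits into a linear image of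
  \<open>A\<close> plus a linear image of \<open>c\<close>.\<close>

lemma twice_differentiable_at_affine_coords:
  assumes "twice_differentiable_at A t" "twice_differentiable_at c t"
  shows "twice_differentiable_at (\<lambda>s. affine_coords (A s) (c s)) t"
proof -
  have linear: "bounded_linear (\<lambda>A. affine_coords A 0)" "bounded_linear (affine_coords 0)"
    by (rule linear_conv_bounded_linear[THEN iffD1], rule linearI;
        simp add: vec_eq_iff affine_coords_def row_def split: sum.split)+
  have "affine_coords A 0 + affine_coords 0 c = affine_coords A c" for A c
    by (simp add: vec_eq_iff affine_coords_def row_def split: sum.split)
  then show ?thesis
    using twice_differentiable_at_add[OF
        twice_differentiable_at_bounded_linear(1)[OF linear(1) assms(1)]
        twice_differentiable_at_bounded_linear(1)[OF linear(2) assms(2)]]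
    by simp
qed

section \<open>Gradients and the chain rule\<close>

lemma GDERIV_grad:
  fixes f :: "'a::euclidean_space \<Rightarrow> real"
  assumes "f differentiable (at p)"
  shows "GDERIV f p :> grad f p"
proof -
  obtain D where D: "(f has_derivative D) (at p)"
    using assms by (auto simp: differentiable_def)
  then interpret D: bounded_linear D
    by (rule has_derivative_bounded_linear)
  \<comment> \<open>Since \<open>D\<close> is real-valued, the adjoint at 1 is its Riesz
    representer, which is the gradient.\<close>
  have "D h = inner h (adjoint D 1)" for h
    using adjoint_works[OF D.linear, of h 1] by simp
  then have "GDERIV f p :> adjoint D 1"
    using D by (simp add: gderiv_def flip: \<open>\<And>h. D h = _\<close>)
  then show ?thesis
    by (simp add: grad_eqI)
qed

text \<open>The derivative in direction \<open>h\<close> pairs \<open>J *v h\<close> with the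
  gradient of \<open>f\<close>; moving \<open>J\<close> across the inner product produces the
  transpose.\<close>

lemma grad_matrix_vector_mult:
  fixes J :: "real^'n^'m"
  assumes "f differentiable (at (J *v p))"
  shows "grad (\<lambda>p. f (J *v p)) p = transpose J *v grad f (J *v p)"
proof (rule grad_eqI)
  have "((\<lambda>p. f (J *v p)) has_derivative (\<lambda>h. inner (J *v h) (grad f (J *v p)))) (at p)"
    using has_derivative_compose[OF bounded_linear_imp_has_derivative[OF matrix_vector_mul_bounded_linear]
      GDERIV_grad[OF assms, unfolded gderiv_def]] .
  then show "GDERIV (\<lambda>p. f (J *v p)) p :> transpose J *v grad f (J *v p)"
    by (simp add: gderiv_def dot_lmul_matrix inner_commute flip: vector_transpose_matrix)
qed

section \<open>Moments of the density and the mass matrix\<close>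

text \<open>The four blocks are \<open>I\<close>, \<open>I \<otimes> x\<^sup>T\<close>,
  \<open>I \<otimes> x\<close> and \<open>I \<otimes> x x\<^sup>T\<close>. Weighted by the density
  and integrated, they give the zeroth, first and second moments.\<close>

lemma affine_jacobian_gram:
  "transpose (affine_jacobian x) ** affine_jacobian x = (\<chi> i i'. case (i, i') of
      (Inl k, Inl l) \<Rightarrow> if k = l then 1 else 0
    | (Inl k, Inr (l, j)) \<Rightarrow> if k = l then x $ j else 0
    | (Inr (k, j), Inl l) \<Rightarrow> if k = l then x $ j else 0
    | (Inr (k, j), Inr (l, j')) \<Rightarrow> if k = l then x $ j * x $ j' else 0)"
  by (simp add: vec_eq_iff matrix_matrix_mult_def transpose_def affine_jacobian_def mat_def
      if_distrib if_distribR cong: if_cong split: sum.split)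

lemma outer_square_nth: "outer_square x $ j $ j' = x $ j * x $ j'"
  by (simp add: outer_square_def matrix_matrix_mult_def columnvector_def rowvector_def)

text \<open>Each coordinate satisfies \<open>\<bar>z\<bar> \<le> 1 + z * z\<close>, so the zeroth
  and second moments dominate the first.\<close>

lemma set_integrable_first_moment:
  assumes "set_integrable lebesgue \<Omega> \<rho>"
    and "set_integrable lebesgue \<Omega> (\<lambda>x. \<rho> x *\<^sub>R outer_square x)"
  shows "set_integrable lebesgue \<Omega> (\<lambda>x. \<rho> x *\<^sub>R x)"
proof (rule set_integrable_vec)
  fix j
  have second: "set_integrable lebesgue \<Omega> (\<lambda>x. \<rho> x * (x $ j * x $ j))"
    using set_integrable_bounded_linear[OF
        bounded_linear_compose[OF bounded_linear_vec_nth[of j] bounded_linear_vec_nth[of j]] assms(2)]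
    by (simp add: outer_square_nth)
  have coord: "(\<lambda>x. x $ j) \<in> borel_measurable lebesgue"
    by (intro measurable_completion)
      (simp add: borel_measurable_continuous_onI continuous_on_component)
  have bound: "\<bar>r * z\<bar> \<le> \<bar>r\<bar> + \<bar>r * (z * z)\<bar>" for r z :: real
  proof -
    have "0 \<le> (\<bar>z\<bar> - 1)\<^sup>2" by simp
    then have "\<bar>z\<bar> \<le> 1 + z * z"
      using zero_le_square[of z] by (simp add: power2_eq_square algebra_simps)
    from mult_left_mono[OF this, of "\<bar>r\<bar>"] show ?thesis
      by (simp add: abs_mult algebra_simps)
  qed
  \<comment> \<open>The indicator stays grouped with \<open>\<rho>\<close> because
    \<open>assms(1)\<close> supplies the measurability of exactly this product.\<close>
  have "integrable lebesgue (\<lambda>x. (indicator \<Omega> x *\<^sub>R \<rho> x) * x $ j)"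
  proof (rule Bochner_Integration.integrable_bound)
    show "integrable lebesgue (\<lambda>x. \<bar>indicator \<Omega> x *\<^sub>R \<rho> x\<bar> + \<bar>indicator \<Omega> x *\<^sub>R (\<rho> x * (x $ j * x $ j))\<bar>)"
      using assms(1) second by (simp add: set_integrable_def)
    show "(\<lambda>x. (indicator \<Omega> x *\<^sub>R \<rho> x) * x $ j) \<in> borel_measurable lebesgue"
      by (intro borel_measurable_times borel_measurable_integrable[OF assms(1)[unfolded set_integrable_def]] coord)
    show "AE x in lebesgue. norm ((indicator \<Omega> x *\<^sub>R \<rho> x) * x $ j)
        \<le> norm (\<bar>indicator \<Omega> x *\<^sub>R \<rho> x\<bar> + \<bar>indicator \<Omega> x *\<^sub>R (\<rho> x * (x $ j * x $ j))\<bar>)"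
      using bound by (auto simp: indicator_def)
  qed
  then show "set_integrable lebesgue \<Omega> (\<lambda>x. (\<rho> x *\<^sub>R x) $ j)"
    by (simp add: set_integrable_def mult.assoc)
qed

text \<open>Integrability is recorded along with the value so that a constant vector can later be
  pulled out of the integral.\<close>

lemma mass_matrix_eq_integral_gram:
  assumes zeroth: "set_integrable lebesgue \<Omega> \<rho>"
    and second: "set_integrable lebesgue \<Omega> (\<lambda>x. \<rho> x *\<^sub>R outer_square x)"
    and centred: "(LINT x:\<Omega>|lebesgue. \<rho> x *\<^sub>R x) = 0"
  defines "G \<equiv> \<lambda>x. \<rho> x *\<^sub>R (transpose (affine_jacobian x) ** affine_jacobian x)"
  shows "set_integrable lebesgue \<Omega> G"
    and "(LINT x:\<Omega>|lebesgue. G x) = mass_matrix \<Omega> \<rho>"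
proof -
  note first = set_integrable_first_moment[OF zeroth second]
  have int1: "set_integrable lebesgue \<Omega> (\<lambda>x. \<rho> x * x $ j)" for j
    using set_integrable_bounded_linear[OF bounded_linear_vec_nth first] by simp
  have int2: "set_integrable lebesgue \<Omega> (\<lambda>x. \<rho> x * (x $ j * x $ j'))" for j j'
    using set_integrable_bounded_linear[OF
        bounded_linear_compose[OF bounded_linear_vec_nth bounded_linear_vec_nth] second]
    by (simp add: outer_square_nth)
  have val1: "(LINT x:\<Omega>|lebesgue. \<rho> x * x $ j) = 0" for j
    using set_integral_vec_nth[OF first, of j] centred by simp
  have val2: "(LINT x:\<Omega>|lebesgue. \<rho> x * (x $ j * x $ j')) = affine_inertia \<Omega> \<rho> $ j $ j'" for j j'
    using set_integral_bounded_linear[OF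
        bounded_linear_compose[OF bounded_linear_vec_nth bounded_linear_vec_nth] second]
    by (simp add: outer_square_nth affine_inertia_def)
  have if_out: "set_integrable lebesgue \<Omega> f \<Longrightarrow> set_integrable lebesgue \<Omega> (\<lambda>x. if P then f x else 0)"
      "(LINT x:\<Omega>|lebesgue. if P then f x else 0) = (if P then LINT x:\<Omega>|lebesgue. f x else 0)"
    for P and f :: "real^3 \<Rightarrow> real"
    by (cases P; simp add: set_integrable_def)+
  \<comment> \<open>The case split runs over the four blocks: the mass, two first-moment blocks that
    vanish by \<open>val1\<close>, and the inertia. The Kronecker deltas do not depend on
    \<open>x\<close> and leave the integral by \<open>if_out\<close>.\<close>
  have comp: "set_integrable lebesgue \<Omega> (\<lambda>x. G x $ i $ i')
      \<and> (LINT x:\<Omega>|lebesgue. G x $ i $ i') = mass_matrix \<Omega> \<rho> $ i $ i'" for i i'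
    using zeroth int1 int2 val1 val2
    by (cases i; cases i'; simp only: G_def)
      (auto simp: affine_jacobian_gram mass_matrix_def body_mass_def mat_def if_out
        if_distrib[where f = "\<lambda>z. \<rho> _ * z"] cong: if_cong)
  show G: "set_integrable lebesgue \<Omega> G"
    using comp by (intro set_integrable_vec) blast
  have row: "set_integrable lebesgue \<Omega> (\<lambda>x. G x $ i)" for i
    using comp by (intro set_integrable_vec) blast
  show "(LINT x:\<Omega>|lebesgue. G x) = mass_matrix \<Omega> \<rho>"
    using comp by (simp add: vec_eq_iff set_integral_vec_nth[OF G] set_integral_vec_nth[OF row])
qed

text \<open>The integrated law is a system of twelve scalar equations, which in general does not
  recover the pointwise law. Hence the equivalence concerns the integrated law, while the pointwise
  law only appears as a premise.\<close>

theorem theorem2: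
  fixes \<Omega> :: "(real^3) set"
    and \<rho> :: "real^3 \<Rightarrow> real"
    and \<phi> :: "real^3 \<Rightarrow> real^3 \<Rightarrow> real"
    and A :: "real \<Rightarrow> real^3^3"
    and c :: "real \<Rightarrow> real^3"
    and t :: real
  defines "q \<equiv> \<lambda>s. affine_coords (A s) (c s)"
    and "y \<equiv> \<lambda>x s. world_pos (A s) (c s) x"
  assumes "\<Omega> \<in> sets lebesgue"
    and "set_integrable lebesgue \<Omega> \<rho>"
    and "set_integrable lebesgue \<Omega> (\<lambda>x. \<rho> x *\<^sub>R outer_square x)"
    and centred: "(LINT x:\<Omega>|lebesgue. \<rho> x *\<^sub>R x) = 0"
    and "twice_differentiable_at A t"
    and "twice_differentiable_at c t"
    and "\<And>x. x \<in> \<Omega> \<Longrightarrow> \<phi> x differentiable (at (y x t))"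
    and "set_integrable lebesgue \<Omega>
           (\<lambda>x. transpose (affine_jacobian x) *v elastic_force \<phi> x (y x t))"
  shows
    "((LINT x:\<Omega>|lebesgue. transpose (affine_jacobian x) *v (\<rho> x *\<^sub>R second_derivative (y x) t))
        = (LINT x:\<Omega>|lebesgue. transpose (affine_jacobian x) *v elastic_force \<phi> x (y x t))
      \<longleftrightarrow>
      mass_matrix \<Omega> \<rho> *v second_derivative q t
        = - (LINT x:\<Omega>|lebesgue. grad (\<lambda>p. \<phi> x (affine_jacobian x *v p)) (q t)))
     \<and>
     ((\<forall>x\<in>\<Omega>. \<rho> x *\<^sub>R second_derivative (y x) t = elastic_force \<phi> x (y x t))
      \<longrightarrow>
      mass_matrix \<Omega> \<rho> *v second_derivative q t
        = - (LINT x:\<Omega>|lebesgue. grad (\<lambda>p. \<phi> x (affine_jacobian x *v p)) (q t)))"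
proof -
  let ?J = affine_jacobian
  let ?a = "second_derivative q t"
  let ?inertial = "LINT x:\<Omega>|lebesgue. transpose (?J x) *v (\<rho> x *\<^sub>R second_derivative (y x) t)"
  let ?elastic = "LINT x:\<Omega>|lebesgue. transpose (?J x) *v elastic_force \<phi> x (y x t)"
  let ?grad = "\<lambda>x. grad (\<lambda>p. \<phi> x (?J x *v p)) (q t)"
  have y: "y x = (\<lambda>s. ?J x *v q s)" for x
    by (simp add: y_def q_def world_pos_eq_jacobian)
  have "twice_differentiable_at q t"
    unfolding q_def using assms by (intro twice_differentiable_at_affine_coords)
  then have acc: "second_derivative (y x) t = ?J x *v ?a" for x
    unfolding y by (rule twice_differentiable_at_bounded_linear(2)[OF matrix_vector_mul_bounded_linear])
  note gram = mass_matrix_eq_integral_gram[OF assms(4,5) centred]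
  \<comment> \<open>The acceleration \<open>?a\<close> is the same for all material points, so only
    the weighted Gram matrix remains under the integral.\<close>
  have "?inertial = (LINT x:\<Omega>|lebesgue. (\<rho> x *\<^sub>R (transpose (?J x) ** ?J x)) *v ?a)"
    by (simp only: acc matrix_vector_mult_scaleR matrix_vector_mul_assoc
        flip: scaleR_matrix_vector_assoc)
  also have "\<dots> = mass_matrix \<Omega> \<rho> *v ?a"
    using set_integral_bounded_linear[OF bounded_linear_matrix_vector_mult_left gram(1)]
    by (simp add: gram(2))
  finally have inertial: "?inertial = mass_matrix \<Omega> \<rho> *v ?a" .
  \<comment> \<open>The chain rule applies at \<open>q t\<close>, which \<open>?J x\<close> maps to
    \<open>y x t\<close>. Differentiability of \<open>\<phi> x\<close> is assumed only for
    \<open>x\<close> in \<open>\<Omega>\<close>, hence the restriction.\<close>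
  have "transpose (?J x) *v elastic_force \<phi> x (y x t) = - ?grad x" if "x \<in> \<Omega>" for x
    using assms(9)[OF that] grad_matrix_vector_mult[of "\<phi> x" "?J x" "q t"]
    by (simp add: y elastic_force_def linear_neg[OF matrix_vector_mul_linear])
  then have "?elastic = (LINT x:\<Omega>|lebesgue. - ?grad x)"
    by (intro set_lebesgue_integral_cong[OF assms(3)]) auto
  then have elastic: "?elastic = - (LINT x:\<Omega>|lebesgue. ?grad x)"
    by (simp add: set_lebesgue_integral_def)
  have "?inertial = ?elastic"
    if "\<forall>x\<in>\<Omega>. \<rho> x *\<^sub>R second_derivative (y x) t = elastic_force \<phi> x (y x t)"
    using that by (intro set_lebesgue_integral_cong[OF assms(3)]) auto
  then show ?thesis
    using inertial elastic by auto
qed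

end
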